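(* Let $\mathcal H$ be a real Hilbert space, $f,g,h$ proper closed convex functions on $\mathcal H$ with $h$ differentiable and $\nabla h$ $(1/\beta)$-Lipschitz, $\beta>0$. Set $A=\partial f$, $B=\partial g$, $C=\nabla h$. Let $\varepsilon\in(0,1)$, $\gamma\in(0,2\beta\varepsilon)$, $\alpha=1/(2-\varepsilon)$, $\lambda\in(0,1/\alpha]$. Let $T:=I_{\mathcal H}-J_{\gamma B}+J_{\gamma A}\circ(2J_{\gamma B}-I_{\mathcal H}-\gamma C\circ J_{\gamma B})$ have a fixed point $z^\ast$, and let $x^\ast=J_{\gamma B}(z^\ast)$, $u_B^\ast=\gamma^{-1}(z^\ast-x^\ast)$. Let $z^0\in\mathcal H$, $z^{k+1}=(1-\lambda)z^k+\lambda Tz^k$, $x_g^k:=J_{\gamma B}(z^k)$, $x_f^k:=J_{\gamma A}(2x_g^k-z^k-\gamma\nabla h(x_g^k))$, and $$\overline x_f^k=\frac2{(k+1)(k+2)}\sum_{i=0}^k(i+1)x_f^i,\qquad\overline x_g^k=\frac2{(k+1)(k+2)}\sum_{i=0}^k(i+1)x_g^i.$$ Then: 1. For all $k\ge0$, $$\frac{-5\|z^0-z^\ast\|\,\|u_B^\ast+Cx^\ast\|}{\lambda(k+1)}\le f(\overline x_f^k)+g(\overline x_g^k)+h(\overline x_g^k)-(f+g+h)(x^\ast)\le\frac{2\|z^\ast-x^\ast\|^2+\left(2+\frac{\gamma}{2\beta\varepsilon-\gamma}\right)\|z^0-z^\ast\|^2+10\gamma\|z^0-z^\ast\|\,\|Cx^\ast\|}{\gamma\lambda(k+1)}.$$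 2. Suppose $f$ is $L$-Lipschitz continuous on the closed ball of center $x^\ast$ and radius $(1+\gamma/\beta)\|z^0-z^\ast\|$. Then for all $k\ge0$ $$0\le f(\overline x_g^k)+g(\overline x_g^k)+h(\overline x_g^k)-(f+g+h)(x^\ast)\le\frac{2\|z^\ast-x^\ast\|^2+\left(2+\frac{\gamma}{2\beta\varepsilon-\gamma}\right)\|z^0-z^\ast\|^2+10\gamma\|z^0-z^\ast\|\,\|Cx^\ast\|+5\gamma L\|z^0-z^\ast\|}{\gamma\lambda(k+1)}.$$
   Context: $J_S:=(I_{\mathcal H}+S)^{-1}$ is the resolvent of a maximal monotone operator $S$; $\partial$ is the convex subdifferential. *)

theory Defs
  imports "HOL-Analysis.Analysis"
begin

definition epigraph_ereal :: "('a \<Rightarrow> ereal) \<Rightarrow> ('a \<times> real) set" where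
  "epigraph_ereal f = {(x, r). f x \<le> ereal r}"

definition proper_closed_convex :: "('a::real_normed_vector \<Rightarrow> ereal) \<Rightarrow> bool" where
  "proper_closed_convex f \<longleftrightarrow>
     (\<forall>x. f x \<noteq> -\<infinity>) \<and> (\<exists>x. f x \<noteq> \<infinity>) \<and>
     closed (epigraph_ereal f) \<and> convex (epigraph_ereal f)"

text \<open>For proper \<open>f\<close> this set is empty wherever \<open>f\<close> is infinite, so no separate domain
  condition is needed.\<close>
definition subdifferential :: "('a::real_inner \<Rightarrow> ereal) \<Rightarrow> 'a \<Rightarrow> 'a set" where
  "subdifferential f x = {u. \<forall>y. f x + ereal (u \<bullet> (y - x)) \<le> f y}"

text \<open>A set-valued operator is a function of type \<open>'a \<Rightarrow> 'a set\<close>.\<close>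
definition scale_operator :: "real \<Rightarrow> ('a \<Rightarrow> 'a set) \<Rightarrow> 'a \<Rightarrow> ('a::real_vector) set" where
  "scale_operator c S x = (\<lambda>u. c *\<^sub>R u) ` S x"

text \<open>\<open>(I + S)\<^sup>-\<^sup>1\<close>: the image \<open>(+) x ` S x\<close> is \<open>(I + S) x\<close>. For a maximal monotone \<open>S\<close> on a
  Hilbert space the point described by \<open>THE\<close> exists and is unique (Minty); for other \<open>S\<close> the
  value may be unspecified.\<close>
definition resolvent :: "('a \<Rightarrow> 'a set) \<Rightarrow> 'a \<Rightarrow> 'a::real_vector" where
  "resolvent S z = (THE x. z \<in> (+) x ` S x)"

end

theory Submission
  imports Defs
begin

text \<open>Monotonicity of the subdifferentials and cocoercivity of the gradient (Baillon--Haddad) make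
  the iterates Fejer monotone with respect to \<open>zs\<close>, with \<open>\<Sum>\<^sub>i \<parallel>C (x_g i) - C xs\<parallel>\<^sup>2\<close> bounded by a
  multiple of \<open>\<parallel>z 0 - zs\<parallel>\<^sup>2\<close>. The subgradient inequalities at \<open>x_f i\<close> and \<open>x_g i\<close> bound the objective
  gap of one iteration by a telescoping term plus such controlled errors. Summing with weights
  \<open>i + 1\<close> and using Jensen's inequality loses only a factor \<open>k + 1\<close> against the total weight
  \<open>(k + 1) (k + 2) / 2\<close>. Since \<open>x_f i - x_g i = (z (i + 1) - z i) / lam\<close>, Abel summation shows that
  the two averages are \<open>O(1/k)\<close> apart, which yields the lower bound and the second part.\<close>


section \<open>Convexity and closedness through the epigraph\<close>

lemma proper_closed_convexD:
  assumes "proper_closed_convex f"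
  shows "f x \<noteq> -\<infinity>" "closed {(x, r). f x \<le> ereal r}" "convex {(x, r). f x \<le> ereal r}"
  using assms by (auto simp: proper_closed_convex_def epigraph_ereal_def)

lemma proper_closed_convex_ereal_cases:
  assumes "proper_closed_convex f"
  obtains r where "f x = ereal r" | "f x = \<infinity>"
  using proper_closed_convexD(1)[OF assms, of x] by (cases "f x") auto

text \<open>Convexity is encoded by the epigraph, so Jensen's inequality amounts to one convex
  combination of the points \<open>(x i, r i)\<close> lying in that set.\<close>

lemma proper_closed_convex_sum_le:
  fixes x :: "'i \<Rightarrow> 'a::real_normed_vector"
  assumes f: "proper_closed_convex f" and "finite I"
    and a: "\<And>i. i \<in> I \<Longrightarrow> 0 \<le> a i" "sum a I = 1"
    and r: "\<And>i. i \<in> I \<Longrightarrow> f (x i) = ereal (r i)"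
  shows "f (\<Sum>i\<in>I. a i *\<^sub>R x i) \<le> ereal (\<Sum>i\<in>I. a i * r i)"
proof -
  have "(\<Sum>i\<in>I. a i *\<^sub>R (x i, r i)) \<in> {(x, r). f x \<le> ereal r}"
    using proper_closed_convexD(3)[OF f] assms by (intro convex_sum) auto
  moreover have "(\<Sum>i\<in>I. a i *\<^sub>R (x i, r i)) = (\<Sum>i\<in>I. a i *\<^sub>R x i, \<Sum>i\<in>I. a i * r i)"
    by (simp add: sum_prod)
  ultimately show ?thesis by simp
qed

text \<open>Lower semicontinuity bounds \<open>f\<close> from below near \<open>x0\<close>; convexity spreads this bound along
  rays from \<open>x0\<close>. This replaces the usual affine minorant and avoids a separation theorem.\<close>
lemma proper_closed_convex_linear_growth:
  fixes f :: "'a::real_normed_vector \<Rightarrow> ereal"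
  assumes f: "proper_closed_convex f" and x0: "f x0 = ereal r0"
  obtains \<delta> where "\<delta> > 0" "\<And>x r. f x \<le> ereal r \<Longrightarrow> r0 - 1 - norm (x - x0) / \<delta> \<le> r"
proof -
  let ?E = "{(x, r). f x \<le> ereal r}"
  have "open (- ?E)"
    using proper_closed_convexD(2)[OF f] by (simp add: open_Compl)
  moreover have "(x0, r0 - 1) \<in> - ?E"
    using x0 by simp
  ultimately obtain e where e: "e > 0" "ball (x0, r0 - 1) e \<subseteq> - ?E"
    by (meson open_contains_ball)
  \<comment> \<open>Epigraphs are closed upwards: a height \<open>r \<le> r0 - 1\<close> over
    \<open>x\<close> would put \<open>(x, r0 - 1)\<close> into the epigraph, at distance
    \<open>norm (x - x0)\<close> from the centre of the excluded ball.\<close>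
  have near: "r0 - 1 < r" if "norm (x - x0) < e" "f x \<le> ereal r" for x r
  proof (rule ccontr)
    assume "\<not> ?thesis"
    then have "f x \<le> ereal (r0 - 1)"
      using that(2) by (meson ereal_less_eq(3) linorder_not_less order_trans)
    moreover have "(x, r0 - 1) \<in> ball (x0, r0 - 1) e"
      using that(1) by (simp add: dist_Pair_Pair dist_norm norm_minus_commute)
    ultimately show False using e(2) by auto
  qed
  show thesis
  proof (rule that[of "e / 2"])
    show "e / 2 > 0" using e by simp
  next
    fix x r assume xr: "f x \<le> ereal r"
    show "r0 - 1 - norm (x - x0) / (e / 2) \<le> r"
    proof (cases "norm (x - x0) < e")
      case True
      then have "r0 - 1 < r" using near xr by blast
      moreover have "norm (x - x0) / (e / 2) \<ge> 0" using e by simp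
      ultimately show ?thesis by linarith
    next
      case False
      define n where "n = norm (x - x0)"
      have n: "n \<ge> e" "n > 0" using False e by (auto simp: n_def)
      \<comment> \<open>This \<open>t\<close> pulls \<open>x\<close> back along its ray to distance
        \<open>e / 2\<close> from \<open>x0\<close>, where \<open>near\<close> applies.\<close>
      define t where "t = e / 2 / n"
      have t: "0 < t" "t \<le> 1" "t * n = e / 2" using n e by (auto simp: t_def field_simps)
      have "(1 - t) *\<^sub>R (x0, r0) + t *\<^sub>R (x, r) \<in> ?E"
        using proper_closed_convexD(3)[OF f] t x0 xr by (intro convexD) auto
      then have "f ((1 - t) *\<^sub>R x0 + t *\<^sub>R x) \<le> ereal ((1 - t) * r0 + t * r)"
        by simp
      moreover have "(1 - t) *\<^sub>R x0 + t *\<^sub>R x - x0 = t *\<^sub>R (x - x0)"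
        by (simp add: algebra_simps)
      then have "norm ((1 - t) *\<^sub>R x0 + t *\<^sub>R x - x0) < e"
        using t e by (simp add: n_def[symmetric])
      ultimately have "r0 - 1 < (1 - t) * r0 + t * r"
        using near by blast
      then have "- 1 < t * (r - r0)" by (simp add: algebra_simps)
      then have "- (1 / t) < r - r0" using t by (simp add: field_simps)
      moreover have "1 / t = n / (e / 2)" using e n by (simp add: t_def)
      ultimately show ?thesis by (simp add: n_def)
    qed
  qed
qed

section \<open>Existence of proximal points\<close>

lemma norm_midpoint_sq:
  fixes u v :: "'a::real_inner"
  shows "(norm ((1 / 2) *\<^sub>R (u + v)))\<^sup>2
    = (norm u)\<^sup>2 / 2 + (norm v)\<^sup>2 / 2 - (norm (u - v))\<^sup>2 / 4"
  by (simp add: power2_norm_eq_inner algebra_simps inner_commute add_divide_distrib diff_divide_distrib)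

text \<open>Direct method: the quadratic term makes every minimizing sequence Cauchy, completeness
  provides a limit, and closedness of the epigraph shows that the infimum is attained there.
  Minimizing over epigraph points \<open>(x, r)\<close> rather than over \<open>x\<close> keeps the
  objective real-valued.\<close>

lemma proximal_point_exists:
  fixes f :: "'a::{real_inner, complete_space} \<Rightarrow> ereal"
  assumes f: "proper_closed_convex f" and c: "c > 0"
  obtains p r where "f p \<le> ereal r"
    "\<And>y s. f y \<le> ereal s \<Longrightarrow> r + c * (norm (p - z))\<^sup>2 \<le> s + c * (norm (y - z))\<^sup>2"
proof -
  let ?E = "{(x, r). f x \<le> ereal r}"
  let ?\<phi> = "\<lambda>(x, r). r + c * (norm (x - z))\<^sup>2"
  obtain x0 where "f x0 \<noteq> \<infinity>" using f by (auto simp: proper_closed_convex_def)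
  then obtain r0 where x0: "f x0 = ereal r0"
    using proper_closed_convex_ereal_cases[OF f] by metis
  obtain \<delta> where \<delta>: "\<delta> > 0" "\<And>x r. f x \<le> ereal r \<Longrightarrow> r0 - 1 - norm (x - x0) / \<delta> \<le> r"
    using proper_closed_convex_linear_growth[OF f x0] by blast
  \<comment> \<open>With \<open>s = norm (x - z)\<close>, completing the square shows that
    \<open>c * s\<^sup>2 - s / \<delta>\<close> is at least
    \<open>- 1 / (4 * c * \<delta>\<^sup>2)\<close>; the quadratic thus beats the linear decay of
    \<open>f\<close>.\<close>
  define b where "b = r0 - 1 - norm (z - x0) / \<delta> - 1 / (4 * c * \<delta>\<^sup>2)"
  have lower: "b \<le> r + c * (norm (x - z))\<^sup>2" if "f x \<le> ereal r" for x r
  proof -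
    have "norm (x - x0) \<le> norm (x - z) + norm (z - x0)"
      using norm_triangle_ineq[of "x - z" "z - x0"] by simp
    then have "norm (x - x0) / \<delta> \<le> norm (x - z) / \<delta> + norm (z - x0) / \<delta>"
      using \<delta>(1) by (simp add: field_simps)
    moreover have "c * (norm (x - z) - 1 / (2 * c * \<delta>))\<^sup>2
        = c * (norm (x - z))\<^sup>2 - norm (x - z) / \<delta> + 1 / (4 * c * \<delta>\<^sup>2)"
      using c \<delta>(1) by (simp add: power2_eq_square field_simps)
    moreover have "0 \<le> c * (norm (x - z) - 1 / (2 * c * \<delta>))\<^sup>2" using c by simp
    ultimately show ?thesis using \<delta>(2)[OF that] unfolding b_def by linarith
  qed
  define m where "m = Inf (?\<phi> ` ?E)"
  have bdd: "bdd_below (?\<phi> ` ?E)"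
    using lower by (intro bdd_belowI[of _ b]) auto
  have ne: "?\<phi> ` ?E \<noteq> {}" using x0 by (auto intro!: exI[of _ x0] exI[of _ r0])
  have m_le: "m \<le> r + c * (norm (x - z))\<^sup>2" if "f x \<le> ereal r" for x r
    unfolding m_def using that by (intro cInf_lower[OF _ bdd]) (auto intro!: image_eqI[of _ _ "(x, r)"])
  define \<eta> where "\<eta> n = inverse (real (Suc n))" for n
  have \<eta>_anti: "\<eta> i \<le> \<eta> j" if "j \<le> i" for i j
    using that by (simp add: \<eta>_def field_simps)
  have "\<exists>x r. f x \<le> ereal r \<and> r + c * (norm (x - z))\<^sup>2 < m + \<eta> n" for n
  proof -
    have "Inf (?\<phi> ` ?E) < m + \<eta> n" by (simp add: m_def \<eta>_def)
    then show ?thesis using cInf_lessD[OF ne] by fastforce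
  qed
  then obtain x r where xr: "\<And>n. f (x n) \<le> ereal (r n)"
    "\<And>n. r n + c * (norm (x n - z))\<^sup>2 < m + \<eta> n"
    by metis
  \<comment> \<open>The midpoint of two near-minimizers still has objective at least
    \<open>m\<close>, while the parallelogram law lowers it by a quarter of the squared distance;
    hence that distance is small.\<close>
  have close: "c * (norm (x i - x j))\<^sup>2 \<le> 2 * (\<eta> i + \<eta> j)" for i j
  proof -
    have "(1 / 2) *\<^sub>R (x i, r i) + (1 / 2) *\<^sub>R (x j, r j) \<in> ?E"
      using proper_closed_convexD(3)[OF f] xr(1) by (intro convexD) auto
    then have "f ((1 / 2) *\<^sub>R x i + (1 / 2) *\<^sub>R x j) \<le> ereal (r i / 2 + r j / 2)" by simp
    note m_le[OF this]
    moreover have "(1 / 2) *\<^sub>R x i + (1 / 2) *\<^sub>R x j - z = (1 / 2) *\<^sub>R ((x i - z) + (x j - z))"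
      by (simp add: algebra_simps flip: scaleR_add_left)
    then have "(norm ((1 / 2) *\<^sub>R x i + (1 / 2) *\<^sub>R x j - z))\<^sup>2
        = (norm (x i - z))\<^sup>2 / 2 + (norm (x j - z))\<^sup>2 / 2 - (norm (x i - x j))\<^sup>2 / 4"
      by (simp only: norm_midpoint_sq) simp
    ultimately have "m \<le> r i / 2 + r j / 2 + c * (norm (x i - z))\<^sup>2 / 2 + c * (norm (x j - z))\<^sup>2 / 2
        - c * (norm (x i - x j))\<^sup>2 / 4"
      by (simp add: algebra_simps)
    then show ?thesis using xr(2)[of i] xr(2)[of j] by argo
  qed
  have \<eta>_lim: "\<eta> \<longlonglongrightarrow> 0"
    using LIMSEQ_inverse_real_of_nat by (simp add: \<eta>_def[abs_def])
  have "Cauchy x"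
  proof (rule metric_CauchyI)
    fix e :: real assume e: "e > 0"
    have "\<forall>\<^sub>F n in sequentially. \<eta> n < c * e\<^sup>2 / 4"
      using c e by (intro order_tendstoD(2)[OF \<eta>_lim]) simp
    then obtain N where N: "\<eta> N < c * e\<^sup>2 / 4"
      unfolding eventually_sequentially by blast
    show "\<exists>M. \<forall>i\<ge>M. \<forall>j\<ge>M. dist (x i) (x j) < e"
    proof (intro exI allI impI)
      fix i j assume "i \<ge> N" "j \<ge> N"
      then have "\<eta> i \<le> \<eta> N" "\<eta> j \<le> \<eta> N" using \<eta>_anti by blast+
      then have "c * (norm (x i - x j))\<^sup>2 < c * e\<^sup>2"
        using close[of i j] N by argo
      then have "(norm (x i - x j))\<^sup>2 < e\<^sup>2" using c by simp
      then show "dist (x i) (x j) < e"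
        using e by (simp add: dist_norm power_less_imp_less_base)
    qed
  qed
  then obtain p where p: "x \<longlonglongrightarrow> p" by (auto simp: Cauchy_convergent_iff convergent_def)
  have phi: "(\<lambda>n. r n + c * (norm (x n - z))\<^sup>2) \<longlonglongrightarrow> m"
  proof (rule tendsto_sandwich)
    show "\<forall>\<^sub>F n in sequentially. m \<le> r n + c * (norm (x n - z))\<^sup>2"
      using m_le xr(1) by simp
    show "\<forall>\<^sub>F n in sequentially. r n + c * (norm (x n - z))\<^sup>2 \<le> m + \<eta> n"
      using xr(2) by (simp add: less_imp_le)
    show "(\<lambda>n. m + \<eta> n) \<longlonglongrightarrow> m"
      using tendsto_add[OF tendsto_const \<eta>_lim, of m] by simp
  qed simp
  \<comment> \<open>The heights \<open>r n\<close> converge because both the objective values and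
    the quadratic terms do.\<close>
  have "(\<lambda>n. (r n + c * (norm (x n - z))\<^sup>2) - c * (norm (x n - z))\<^sup>2)
      \<longlonglongrightarrow> m - c * (norm (p - z))\<^sup>2"
    by (intro tendsto_intros phi p)
  then have lim: "(\<lambda>n. (x n, r n)) \<longlonglongrightarrow> (p, m - c * (norm (p - z))\<^sup>2)"
    using p by (intro tendsto_Pair) auto
  have "(x n, r n) \<in> ?E" for n using xr(1) by simp
  then have "(p, m - c * (norm (p - z))\<^sup>2) \<in> ?E"
    by (rule closed_sequentially[OF proper_closed_convexD(2)[OF f] _ lim])
  then show thesis
    using m_le that[of p "m - c * (norm (p - z))\<^sup>2"] by simp
qed

text \<open>First-order optimality of the proximal point: compare \<open>p\<close> with points on
  the segment towards \<open>y\<close>, divide by the step \<open>t\<close>, and let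
  \<open>t\<close> tend to 0. This is the existence half of Minty's theorem for
  subdifferentials.\<close>

lemma proximal_inclusion_exists:
  fixes f :: "'a::{real_inner, complete_space} \<Rightarrow> ereal"
  assumes f: "proper_closed_convex f" and c: "c > 0"
  shows "\<exists>p. (1 / c) *\<^sub>R (z - p) \<in> subdifferential f p"
proof -
  \<comment> \<open>Differentiating \<open>b * (norm (y - z))\<^sup>2\<close> then produces the
    factor \<open>2 * b = 1 / c\<close> of the claimed subgradient.\<close>
  define b where "b = 1 / (2 * c)"
  have b: "b > 0" using c by (simp add: b_def)
  obtain p r where p: "f p \<le> ereal r"
    "\<And>y s. f y \<le> ereal s \<Longrightarrow> r + b * (norm (p - z))\<^sup>2 \<le> s + b * (norm (y - z))\<^sup>2"
    using proximal_point_exists[OF f b, of z] by blast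
  have "f p + ereal ((1 / c) *\<^sub>R (z - p) \<bullet> (y - p)) \<le> f y" for y
  proof (cases y rule: proper_closed_convex_ereal_cases[OF f])
    case (1 s)
    have step: "0 \<le> s - r + 2 * b * ((p - z) \<bullet> (y - p)) + t * (b * (norm (y - p))\<^sup>2)"
      if t: "0 < t" "t \<le> 1" for t
    proof -
      have "(1 - t) *\<^sub>R (p, r) + t *\<^sub>R (y, s) \<in> {(x, r). f x \<le> ereal r}"
        using proper_closed_convexD(3)[OF f] t p(1) 1 by (intro convexD) auto
      then have "f ((1 - t) *\<^sub>R p + t *\<^sub>R y) \<le> ereal ((1 - t) * r + t * s)" by simp
      note le = p(2)[OF this]
      have eq: "(1 - t) *\<^sub>R p + t *\<^sub>R y - z = (p - z) + t *\<^sub>R (y - p)"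
        by (simp add: algebra_simps)
      have sq: "(norm ((p - z) + t *\<^sub>R (y - p)))\<^sup>2
          = (norm (p - z))\<^sup>2 + 2 * t * ((p - z) \<bullet> (y - p)) + t\<^sup>2 * (norm (y - p))\<^sup>2"
        unfolding power2_norm_eq_inner
        by (simp add: inner_add_left inner_add_right inner_commute power2_eq_square)
      have "t * (s - r + 2 * b * ((p - z) \<bullet> (y - p)) + t * (b * (norm (y - p))\<^sup>2))
          = ((1 - t) * r + t * s + b * ((norm (p - z))\<^sup>2 + 2 * t * ((p - z) \<bullet> (y - p))
            + t\<^sup>2 * (norm (y - p))\<^sup>2)) - (r + b * (norm (p - z))\<^sup>2)"
        by (simp add: power2_eq_square[of t] distrib_left distrib_right left_diff_distrib
            right_diff_distrib mult.commute mult.left_commute)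
      then have "0 \<le> t * (s - r + 2 * b * ((p - z) \<bullet> (y - p)) + t * (b * (norm (y - p))\<^sup>2))"
        using le[unfolded eq sq] by linarith
      then show ?thesis using t by (simp add: zero_le_mult_iff)
    qed
    have "((\<lambda>t. s - r + 2 * b * ((p - z) \<bullet> (y - p)) + t * (b * (norm (y - p))\<^sup>2)) \<longlongrightarrow>
        s - r + 2 * b * ((p - z) \<bullet> (y - p)) + 0 * (b * (norm (y - p))\<^sup>2)) (at_right 0)"
      by (intro tendsto_intros)
    moreover have "\<forall>\<^sub>F t in at_right 0. 0 \<le> s - r + 2 * b * ((p - z) \<bullet> (y - p)) + t * (b * (norm (y - p))\<^sup>2)"
      using step by (auto simp: eventually_at_right_field intro!: exI[of _ 1])
    ultimately have "0 \<le> s - r + 2 * b * ((p - z) \<bullet> (y - p)) + 0 * (b * (norm (y - p))\<^sup>2)"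
      by (rule tendsto_lowerbound) simp
    then have "r + (1 / c) *\<^sub>R (z - p) \<bullet> (y - p) \<le> s"
      using c by (simp add: b_def field_simps inner_diff_left)
    \<comment> \<open>The height \<open>r\<close> only dominates \<open>f p\<close>; replacing it by
      \<open>q \<le> r\<close> preserves the inequality.\<close>
    moreover obtain q where q: "f p = ereal q"
      using p(1) by (cases p rule: proper_closed_convex_ereal_cases[OF f]) auto
    ultimately show ?thesis using 1 p(1) by simp
  qed simp
  then show ?thesis by (auto simp: subdifferential_def)
qed

section \<open>Subdifferentials and their resolvents\<close>

lemma subdifferential_finite:
  assumes f: "proper_closed_convex f" and u: "u \<in> subdifferential f x"
  obtains r where "f x = ereal r"
proof -
  obtain y where "f y \<noteq> \<infinity>" using f by (auto simp: proper_closed_convex_def)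
  moreover have "f x + ereal (u \<bullet> (y - x)) \<le> f y"
    using u by (simp add: subdifferential_def)
  ultimately have "f x \<noteq> \<infinity>" by auto
  then show thesis using that proper_closed_convex_ereal_cases[OF f] by metis
qed

lemma subdifferential_ineq:
  assumes "u \<in> subdifferential f x" "f x = ereal r" "f y = ereal s"
  shows "r + u \<bullet> (y - x) \<le> s"
proof -
  have "f x + ereal (u \<bullet> (y - x)) \<le> f y" using assms(1) by (simp add: subdifferential_def)
  then show ?thesis using assms by simp
qed

lemma subdifferential_monotone:
  assumes f: "proper_closed_convex f"
    and "u \<in> subdifferential f x" "v \<in> subdifferential f y"
  shows "0 \<le> (u - v) \<bullet> (x - y)"
proof -
  obtain r s where rs: "f x = ereal r" "f y = ereal s"
    using subdifferential_finite[OF f] assms by metis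
  have "r + u \<bullet> (y - x) \<le> s" "s + v \<bullet> (x - y) \<le> r"
    using subdifferential_ineq assms rs by blast+
  then show ?thesis by (simp add: inner_diff_left inner_diff_right)
qed

text \<open>This discharges the \<open>THE\<close> in \<open>resolvent\<close>: existence comes from
  the proximal point, uniqueness from monotonicity, since two solutions would give
  \<open>- (norm (x - y))\<^sup>2 / c \<ge> 0\<close>. Afterwards resolvents enter only through this
  inclusion.\<close>

lemma resolvent_subdifferential:
  fixes f :: "'a::{real_inner, complete_space} \<Rightarrow> ereal" and z :: 'a
  assumes f: "proper_closed_convex f" and c: "c > 0"
  defines "p \<equiv> resolvent (scale_operator c (subdifferential f)) z"
  shows "(1 / c) *\<^sub>R (z - p) \<in> subdifferential f p"
proof -
  let ?P = "\<lambda>x. z \<in> (+) x ` scale_operator c (subdifferential f) x"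
  have iff: "?P x \<longleftrightarrow> (1 / c) *\<^sub>R (z - x) \<in> subdifferential f x" for x
  proof
    assume "?P x"
    then obtain u where u: "z = x + c *\<^sub>R u" "u \<in> subdifferential f x"
      by (auto simp: scale_operator_def)
    then have "(1 / c) *\<^sub>R (z - x) = u" using c by simp
    then show "(1 / c) *\<^sub>R (z - x) \<in> subdifferential f x" using u by simp
  next
    assume u: "(1 / c) *\<^sub>R (z - x) \<in> subdifferential f x"
    have "z = x + c *\<^sub>R ((1 / c) *\<^sub>R (z - x))" using c by simp
    then show "?P x" using u unfolding scale_operator_def by blast
  qed
  have "\<exists>!x. ?P x"
  proof (rule ex_ex1I)
    show "\<exists>x. ?P x" using proximal_inclusion_exists[OF f c] by (simp only: iff)
  next
    fix x y assume "?P x" "?P y"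
    then have "0 \<le> ((1 / c) *\<^sub>R (z - x) - (1 / c) *\<^sub>R (z - y)) \<bullet> (x - y)"
      using subdifferential_monotone[OF f] by (simp only: iff)
    also have "\<dots> = - ((1 / c) * ((x - y) \<bullet> (x - y)))"
      by (simp add: inner_diff_left inner_diff_right diff_divide_distrib)
    finally have "(x - y) \<bullet> (x - y) \<le> 0"
      using c by (simp add: divide_le_0_iff)
    then show "x = y"
      by (metis inner_eq_zero_iff inner_ge_zero order_antisym right_minus_eq)
  qed
  then have "?P p" unfolding p_def resolvent_def by (rule theI')
  then show ?thesis by (simp only: iff)
qed

section \<open>Smooth convex functions and cocoercivity of the gradient\<close>

lemma GDERIV_along_line:
  assumes "\<And>x. GDERIV h x :> C x"
  shows "((\<lambda>t. h (x + t *\<^sub>R v)) has_real_derivative C (x + t *\<^sub>R v) \<bullet> v) (at t)"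
proof -
  have "(h has_derivative (\<lambda>w. w \<bullet> C (x + t *\<^sub>R v))) (at (x + t *\<^sub>R v))"
    using assms by (simp add: gderiv_def)
  then have "((\<lambda>t. h (x + t *\<^sub>R v)) has_derivative (\<lambda>s. (s *\<^sub>R v) \<bullet> C (x + t *\<^sub>R v))) (at t)"
    by (rule has_derivative_compose[rotated]) (auto intro!: derivative_eq_intros)
  moreover have "(\<lambda>s. (s *\<^sub>R v) \<bullet> C (x + t *\<^sub>R v)) = (*) (C (x + t *\<^sub>R v) \<bullet> v)"
    by (simp add: fun_eq_iff inner_commute)
  ultimately show ?thesis by (simp add: has_field_derivative_def)
qed

text \<open>Restricting \<open>h\<close> to a line through \<open>x\<close> reduces the claim to a
  convex function of one real variable, which lies above its tangents.\<close>

lemma gradient_in_subdifferential: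
  assumes h: "proper_closed_convex (\<lambda>x. ereal (h x))" and grad: "\<And>x. GDERIV h x :> C x"
  shows "C x \<in> subdifferential (\<lambda>x. ereal (h x)) x"
proof -
  have "h x + C x \<bullet> (y - x) \<le> h y" for y
  proof -
    let ?\<phi> = "\<lambda>t. h (x + t *\<^sub>R (y - x))"
    have "convex_on UNIV ?\<phi>"
    proof (rule convex_onI)
      fix t a b :: real assume t: "0 < t" "t < 1"
      have "(1 - t) *\<^sub>R (x + a *\<^sub>R (y - x), ?\<phi> a) + t *\<^sub>R (x + b *\<^sub>R (y - x), ?\<phi> b)
          \<in> {(x, r). ereal (h x) \<le> ereal r}"
        using proper_closed_convexD(3)[OF h] t by (intro convexD) auto
      moreover have "(1 - t) *\<^sub>R (x + a *\<^sub>R (y - x)) + t *\<^sub>R (x + b *\<^sub>R (y - x))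
          = x + ((1 - t) *\<^sub>R a + t *\<^sub>R b) *\<^sub>R (y - x)"
        by (simp add: algebra_simps)
      ultimately show "?\<phi> ((1 - t) *\<^sub>R a + t *\<^sub>R b) \<le> (1 - t) * ?\<phi> a + t * ?\<phi> b" by simp
    qed simp
    then have "?\<phi> 1 - ?\<phi> 0 \<ge> (C x \<bullet> (y - x)) * (1 - 0)"
      by (rule convex_on_imp_above_tangent)
        (use GDERIV_along_line[OF grad, of x "y - x" 0] in auto)
    then show ?thesis by simp
  qed
  then show ?thesis by (simp add: subdifferential_def)
qed

text \<open>Along the segment, \<open>h\<close> minus its tangent and minus the quadratic has a
  nonpositive derivative, by Cauchy-Schwarz and the Lipschitz bound; monotonicity takes the place of
  an integral.\<close>

lemma descent_lemma:
  assumes grad: "\<And>x. GDERIV h x :> C x" and lip: "(1 / \<beta>)-lipschitz_on UNIV C"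
  shows "h y \<le> h x + C x \<bullet> (y - x) + (norm (y - x))\<^sup>2 / (2 * \<beta>)"
proof -
  define v where "v = y - x"
  let ?\<psi> = "\<lambda>t. h (x + t *\<^sub>R v) - t * (C x \<bullet> v) - t\<^sup>2 * ((norm v)\<^sup>2 / (2 * \<beta>))"
  have "?\<psi> 1 \<le> ?\<psi> 0"
  proof (rule DERIV_nonpos_imp_nonincreasing[where f = ?\<psi>])
    fix t :: real assume t: "0 \<le> t" "t \<le> 1"
    have "(C (x + t *\<^sub>R v) - C x) \<bullet> v \<le> norm (C (x + t *\<^sub>R v) - C x) * norm v"
      by (rule norm_cauchy_schwarz)
    also have "\<dots> \<le> (1 / \<beta> * norm (t *\<^sub>R v)) * norm v"
      using lipschitz_onD[OF lip, of "x + t *\<^sub>R v" x]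
      by (intro mult_right_mono) (auto simp: dist_norm)
    finally have "C (x + t *\<^sub>R v) \<bullet> v - C x \<bullet> v - 2 * t * ((norm v)\<^sup>2 / (2 * \<beta>)) \<le> 0"
      using t by (simp add: inner_diff_left power2_eq_square)
    moreover have "(?\<psi> has_real_derivative
        C (x + t *\<^sub>R v) \<bullet> v - C x \<bullet> v - 2 * t * ((norm v)\<^sup>2 / (2 * \<beta>))) (at t)"
      by (rule derivative_eq_intros GDERIV_along_line[OF grad] refl | simp)+
    ultimately show "\<exists>D. (?\<psi> has_real_derivative D) (at t) \<and> D \<le> 0" by blast
  qed simp
  then show ?thesis by (simp add: v_def)
qed

text \<open>The sharpened subgradient inequality \<open>half\<close> is used with \<open>x\<close>
  and \<open>y\<close> in both orders. Adding cancels the function values, and the two constants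
  \<open>\<beta> / 2\<close> combine to \<open>\<beta>\<close>.\<close>

lemma baillon_haddad:
  fixes h :: "'a::real_inner \<Rightarrow> real"
  assumes h: "proper_closed_convex (\<lambda>x. ereal (h x))" and grad: "\<And>x. GDERIV h x :> C x"
    and \<beta>: "\<beta> > 0" and lip: "(1 / \<beta>)-lipschitz_on UNIV C"
  shows "\<beta> * (norm (C x - C y))\<^sup>2 \<le> (C x - C y) \<bullet> (x - y)"
proof -
  have half: "h x + C x \<bullet> (y - x) + \<beta> / 2 * (norm (C y - C x))\<^sup>2 \<le> h y" for x y
  proof -
    \<comment> \<open>A gradient step from \<open>y\<close> for the convex function \<open>h - C x \<bullet> _\<close>, which \<open>x\<close> minimizes.\<close>
    define w where "w = y - \<beta> *\<^sub>R (C y - C x)"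
    have "h x + C x \<bullet> (w - x) \<le> h w"
      using subdifferential_ineq[OF gradient_in_subdifferential[OF h grad]] by blast
    also have "h w \<le> h y + C y \<bullet> (w - y) + (norm (w - y))\<^sup>2 / (2 * \<beta>)"
      by (rule descent_lemma[OF grad lip])
    finally have "h x + C x \<bullet> (y - x) \<le> h y + (C y - C x) \<bullet> (w - y) + (norm (w - y))\<^sup>2 / (2 * \<beta>)"
      by (simp add: algebra_simps)
    moreover have "(C y - C x) \<bullet> (w - y) = - \<beta> * (norm (C y - C x))\<^sup>2"
      by (simp add: w_def power2_norm_eq_inner)
    moreover have "(norm (w - y))\<^sup>2 / (2 * \<beta>) = \<beta> / 2 * (norm (C y - C x))\<^sup>2"
      using \<beta> by (simp add: w_def power2_eq_square)
    ultimately show ?thesis by simp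
  qed
  show ?thesis using half[of x y] half[of y x]
    by (simp add: norm_minus_commute inner_diff_left inner_diff_right)
qed

section \<open>One-step inequalities of the splitting iteration\<close>

text \<open>Young's inequality, from expanding the square of \<open>u + (1 / e) *\<^sub>R v\<close>.
  It is applied with \<open>e = \<epsilon>\<close> to split products of the step with the gradient
  error.\<close>

lemma two_inner_le_weighted:
  fixes u v :: "'a::real_inner"
  assumes "e > 0"
  shows "- 2 * (u \<bullet> v) \<le> e * (norm u)\<^sup>2 + (norm v)\<^sup>2 / e"
proof -
  have "0 \<le> e * (norm (u + (1 / e) *\<^sub>R v))\<^sup>2" using assms by simp
  also have "\<dots> = e * (norm u)\<^sup>2 + 2 * (u \<bullet> v) + (norm v)\<^sup>2 / e"
    using assms unfolding power2_norm_eq_inner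
    by (simp add: inner_add_left inner_add_right inner_commute field_simps)
  finally show ?thesis by simp
qed

text \<open>Here \<open>w\<close>, \<open>p\<close>, \<open>q\<close>, \<open>c\<close> stand for the deviations of \<open>z\<close>, \<open>x_g\<close>, \<open>x_f\<close> and of the gradient at
  \<open>x_g\<close> from their values at the fixed point, and \<open>A\<close>, \<open>B\<close>, \<open>C\<close> are the monotonicity and
  cocoercivity inequalities between the two.\<close>
lemma davis_yin_fejer:
  fixes w p q c :: "'a::real_inner"
  assumes "\<epsilon> > 0" "\<gamma> > 0" "lam > 0"
    and B: "0 \<le> p \<bullet> (w - p)"
    and A: "0 \<le> q \<bullet> (2 *\<^sub>R p - w - \<gamma> *\<^sub>R c - q)"
    and C: "\<beta> * (norm c)\<^sup>2 \<le> c \<bullet> p"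
  shows "(norm (w + lam *\<^sub>R (q - p)))\<^sup>2 \<le> (norm w)\<^sup>2 - lam * (2 - \<epsilon> - lam) * (norm (q - p))\<^sup>2
    - lam * \<gamma> * (2 * \<beta> - \<gamma> / \<epsilon>) * (norm c)\<^sup>2"
proof -
  define d where "d = q - p"
  have q: "q = p + d" by (simp add: d_def)
  \<comment> \<open>After substituting \<open>q = p + d\<close> the sum of \<open>A\<close> and
    \<open>B\<close> retains \<open>p\<close> only in \<open>c \<bullet> p\<close>, which
    cocoercivity controls.\<close>
  have "w \<bullet> d + d \<bullet> d \<le> - \<gamma> * (c \<bullet> p) - \<gamma> * (d \<bullet> c)"
    using add_mono[OF A B] unfolding q by (simp add: algebra_simps inner_commute)
  moreover have "\<gamma> * (\<beta> * (norm c)\<^sup>2) \<le> \<gamma> * (c \<bullet> p)" using C assms(2) by simp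
  moreover have "- 2 * (d \<bullet> (\<gamma> *\<^sub>R c)) \<le> \<epsilon> * (norm d)\<^sup>2 + (norm (\<gamma> *\<^sub>R c))\<^sup>2 / \<epsilon>"
    using two_inner_le_weighted[OF assms(1)] .
  ultimately have "2 * (w \<bullet> d) + 2 * (norm d)\<^sup>2
      \<le> \<epsilon> * (norm d)\<^sup>2 + \<gamma>\<^sup>2 * (norm c)\<^sup>2 / \<epsilon> - 2 * (\<gamma> * (\<beta> * (norm c)\<^sup>2))"
    by (simp add: power_mult_distrib power2_norm_eq_inner)
  then have "lam * (2 * (w \<bullet> d) + 2 * (norm d)\<^sup>2)
      \<le> lam * (\<epsilon> * (norm d)\<^sup>2 + \<gamma>\<^sup>2 * (norm c)\<^sup>2 / \<epsilon> - 2 * (\<gamma> * (\<beta> * (norm c)\<^sup>2)))"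
    using assms(3) by simp
  moreover have "(norm (w + lam *\<^sub>R d))\<^sup>2 = (norm w)\<^sup>2 + 2 * lam * (w \<bullet> d) + lam\<^sup>2 * (norm d)\<^sup>2"
    unfolding power2_norm_eq_inner
    by (simp add: inner_add_left inner_add_right inner_commute power2_eq_square)
  ultimately show ?thesis
    unfolding d_def[symmetric] by (simp add: algebra_simps power2_eq_square)
qed

text \<open>For subgradients at the iterates, the left side dominates the scaled objective gap of
  one step. It reduces to products with \<open>xf - xg\<close>. The gradient is split as
  \<open>(c - cs) + cs\<close>: the first part is absorbed by Young's inequality, the second is kept
  exact because it telescopes along the iteration.\<close>

lemma davis_yin_objective:
  fixes z x xg xf c cs :: "'a::real_inner"
  assumes "\<epsilon> > 0" "\<gamma> > 0" "lam > 0" "lam \<le> 2 - \<epsilon>"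
  shows "\<gamma> * lam * (((1 / \<gamma>) *\<^sub>R (2 *\<^sub>R xg - z - \<gamma> *\<^sub>R c - xf)) \<bullet> (xf - x)
      + ((1 / \<gamma>) *\<^sub>R (z - xg)) \<bullet> (xg - x) + c \<bullet> (xg - x))
    \<le> ((norm (z - x))\<^sup>2 - (norm (z + lam *\<^sub>R (xf - xg) - x))\<^sup>2) / 2
      + lam * \<gamma>\<^sup>2 / (2 * \<epsilon>) * (norm (c - cs))\<^sup>2 - \<gamma> * (cs \<bullet> (lam *\<^sub>R (xf - xg)))"
proof -
  define d where "d = xf - xg"
  define K where "K = \<gamma>\<^sup>2 * (norm (c - cs))\<^sup>2 / \<epsilon>"
  define w where "w = z - x"
  have xf: "xf = xg + d" and z: "z = x + w" by (simp_all add: d_def w_def)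
  let ?L = "((1 / \<gamma>) *\<^sub>R (2 *\<^sub>R xg - z - \<gamma> *\<^sub>R c - xf)) \<bullet> (xf - x)
      + ((1 / \<gamma>) *\<^sub>R (z - xg)) \<bullet> (xg - x) + c \<bullet> (xg - x)"
  have "\<gamma> * ?L = (2 *\<^sub>R xg - z - \<gamma> *\<^sub>R c - xf) \<bullet> (xf - x) + (z - xg) \<bullet> (xg - x)
      + \<gamma> * (c \<bullet> (xg - x))"
    using assms(2) by (simp add: distrib_left)
  also have "\<dots> = - (w \<bullet> d) - d \<bullet> d - \<gamma> * (c \<bullet> d)"
    unfolding xf z by (simp add: algebra_simps inner_commute)
  finally have L: "\<gamma> * lam * ?L = lam * (- (w \<bullet> d) - (norm d)\<^sup>2 - \<gamma> * (c \<bullet> d))"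
    by (simp add: mult.commute mult.left_commute power2_norm_eq_inner)
  have "(norm (z + lam *\<^sub>R d - x))\<^sup>2
      = (norm w)\<^sup>2 + 2 * lam * (w \<bullet> d) + lam\<^sup>2 * (norm d)\<^sup>2"
    unfolding z power2_norm_eq_inner
    by (simp add: inner_add_left inner_add_right inner_commute power2_eq_square)
  moreover have "lam * (- 2 * (\<gamma> * (c \<bullet> d) - \<gamma> * (cs \<bullet> d)))
      \<le> lam * (\<epsilon> * (norm d)\<^sup>2 + K)"
    using two_inner_le_weighted[OF assms(1), of d "\<gamma> *\<^sub>R (c - cs)"] assms(3)
    by (intro mult_left_mono)
      (simp_all add: K_def power_mult_distrib inner_diff_right inner_commute right_diff_distrib)
  \<comment> \<open>The relaxation bound \<open>lam \<le> 2 - \<epsilon>\<close> makes the total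
    coefficient of \<open>(norm d)\<^sup>2\<close> have the right sign after Young's inequality has
    used up \<open>\<epsilon>\<close>.\<close>
  moreover have "lam * lam * (norm d)\<^sup>2 \<le> lam * (2 - \<epsilon>) * (norm d)\<^sup>2"
    using assms by (intro mult_right_mono mult_left_mono) auto
  moreover have K: "lam * \<gamma>\<^sup>2 / (2 * \<epsilon>) * (norm (c - cs))\<^sup>2 = lam * K / 2"
    by (simp add: K_def)
  ultimately show ?thesis
    unfolding L K K_def[symmetric] unfolding d_def[symmetric] w_def[symmetric]
    by (simp add: distrib_left distrib_right left_diff_distrib right_diff_distrib
        power2_eq_square[of lam] diff_divide_distrib add_divide_distrib
        mult.assoc mult.commute mult.left_commute)
qed

section \<open>Abel summation and ergodic weights\<close>

lemma weighted_telescope: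
  fixes a :: "nat \<Rightarrow> 'a::real_vector"
  shows "(\<Sum>i=0..k. (real i + 1) *\<^sub>R (a (Suc i) - a i))
    = (real k + 1) *\<^sub>R a (Suc k) - (\<Sum>i=0..k. a i)"
  by (induction k) (simp_all add: algebra_simps scaleR_2)

text \<open>Increments do not change when \<open>a\<close> is centred at \<open>b\<close>; after
  Abel summation the boundary term and the plain sum each contribute at most
  \<open>(k + 1) * R\<close>.\<close>

lemma norm_weighted_increments_le:
  fixes a :: "nat \<Rightarrow> 'a::real_normed_vector"
  assumes "\<And>i. norm (a i - b) \<le> R"
  shows "norm (\<Sum>i=0..k. (real i + 1) *\<^sub>R (a (Suc i) - a i)) \<le> 2 * (real k + 1) * R"
proof -
  have "(\<Sum>i=0..k. (real i + 1) *\<^sub>R (a (Suc i) - a i))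
      = (real k + 1) *\<^sub>R (a (Suc k) - b) - (\<Sum>i=0..k. a i - b)"
    using weighted_telescope[of "\<lambda>i. a i - b" k] by simp
  also have "norm \<dots> \<le> norm ((real k + 1) *\<^sub>R (a (Suc k) - b)) + norm (\<Sum>i=0..k. a i - b)"
    by (rule norm_triangle_ineq4)
  also have "norm ((real k + 1) *\<^sub>R (a (Suc k) - b)) \<le> (real k + 1) * R"
    using assms[of "Suc k"] by (simp add: mult_left_mono)
  also have "norm (\<Sum>i=0..k. a i - b) \<le> (\<Sum>i=0..k. R)"
    by (rule sum_norm_le) (use assms in auto)
  finally show ?thesis by (simp add: algebra_simps)
qed

lemma sum_ergodic_weights:
  "(\<Sum>i=0..k. 2 / ((real k + 1) * (real k + 2)) * (real i + 1)) = 1"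
proof -
  have "(\<Sum>i=0..k. real i + 1) = (real k + 1) * (real k + 2) / 2"
    by (induction k) (auto simp: field_simps)
  then show ?thesis by (simp only: flip: sum_distrib_left) simp
qed

theorem corollaryD7:
  fixes f g :: "'a::{real_inner, complete_space} \<Rightarrow> ereal"
    and h :: "'a \<Rightarrow> real"
    and A B :: "'a \<Rightarrow> 'a set"
    and C T :: "'a \<Rightarrow> 'a"
    and \<beta> \<epsilon> \<gamma> \<alpha> lam :: real
    and z x_f x_g xbar_f xbar_g :: "nat \<Rightarrow> 'a"
    and zs xs uBs :: 'a
  assumes f: "proper_closed_convex f"
    and g: "proper_closed_convex g"
    and h: "proper_closed_convex (\<lambda>x. ereal (h x))"
    and grad_h: "\<And>x. GDERIV h x :> C x"
    and \<beta>: "\<beta> > 0"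
    and lipschitz_C: "(1 / \<beta>)-lipschitz_on UNIV C"
    and A: "A = subdifferential f"
    and B: "B = subdifferential g"
    and \<epsilon>: "\<epsilon> \<in> {0<..<1}"
    and \<gamma>: "\<gamma> \<in> {0<..<2 * \<beta> * \<epsilon>}"
    and \<alpha>: "\<alpha> = 1 / (2 - \<epsilon>)"
    and lam: "lam \<in> {0<..1 / \<alpha>}"
    and T: "\<And>y. T y = y - resolvent (scale_operator \<gamma> B) y
              + resolvent (scale_operator \<gamma> A)
                  (2 *\<^sub>R resolvent (scale_operator \<gamma> B) y - y
                    - \<gamma> *\<^sub>R C (resolvent (scale_operator \<gamma> B) y))"
    and zs: "T zs = zs"
    and xs: "xs = resolvent (scale_operator \<gamma> B) zs"
    and uBs: "uBs = (1 / \<gamma>) *\<^sub>R (zs - xs)"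
    and z_Suc: "\<And>k. z (Suc k) = (1 - lam) *\<^sub>R z k + lam *\<^sub>R T (z k)"
    and x_g: "\<And>k. x_g k = resolvent (scale_operator \<gamma> B) (z k)"
    and x_f: "\<And>k. x_f k = resolvent (scale_operator \<gamma> A)
                (2 *\<^sub>R x_g k - z k - \<gamma> *\<^sub>R C (x_g k))"
    and xbar_f: "\<And>k. xbar_f k = (2 / ((real k + 1) * (real k + 2))) *\<^sub>R
                (\<Sum>i=0..k. (real i + 1) *\<^sub>R x_f i)"
    and xbar_g: "\<And>k. xbar_g k = (2 / ((real k + 1) * (real k + 2))) *\<^sub>R
                (\<Sum>i=0..k. (real i + 1) *\<^sub>R x_g i)"
  shows "(\<forall>k.
      ereal (- 5 * norm (z 0 - zs) * norm (uBs + C xs) / (lam * (real k + 1)))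
        \<le> f (xbar_f k) + g (xbar_g k) + ereal (h (xbar_g k))
            - (f xs + g xs + ereal (h xs)) \<and>
      f (xbar_f k) + g (xbar_g k) + ereal (h (xbar_g k)) - (f xs + g xs + ereal (h xs))
        \<le> ereal ((2 * (norm (zs - xs))\<^sup>2
              + (2 + \<gamma> / (2 * \<beta> * \<epsilon> - \<gamma>)) * (norm (z 0 - zs))\<^sup>2
              + 10 * \<gamma> * norm (z 0 - zs) * norm (C xs))
            / (\<gamma> * lam * (real k + 1))))
    \<and> (\<forall>L.
        (\<forall>x \<in> cball xs ((1 + \<gamma> / \<beta>) * norm (z 0 - zs)). \<bar>f x\<bar> \<noteq> \<infinity>) \<and>
        L-lipschitz_on (cball xs ((1 + \<gamma> / \<beta>) * norm (z 0 - zs))) (\<lambda>x. real_of_ereal (f x))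
        \<longrightarrow> (\<forall>k.
          0 \<le> f (xbar_g k) + g (xbar_g k) + ereal (h (xbar_g k))
                - (f xs + g xs + ereal (h xs)) \<and>
          f (xbar_g k) + g (xbar_g k) + ereal (h (xbar_g k)) - (f xs + g xs + ereal (h xs))
            \<le> ereal ((2 * (norm (zs - xs))\<^sup>2
                  + (2 + \<gamma> / (2 * \<beta> * \<epsilon> - \<gamma>)) * (norm (z 0 - zs))\<^sup>2
                  + 10 * \<gamma> * norm (z 0 - zs) * norm (C xs)
                  + 5 * \<gamma> * L * norm (z 0 - zs))
                / (\<gamma> * lam * (real k + 1)))))"
proof -

  \<comment> \<open>Subgradients at the iterates and at the fixed point\<close>
  define JA where "JA = resolvent (scale_operator \<gamma> A)"
  define JB where "JB = resolvent (scale_operator \<gamma> B)"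
  define \<Delta> where "\<Delta> = norm (z 0 - zs)"
  define D where "D i = x_f i - x_g i" for i
  define uA where "uA i = (1 / \<gamma>) *\<^sub>R (2 *\<^sub>R x_g i - z i - \<gamma> *\<^sub>R C (x_g i) - x_f i)" for i
  define uB where "uB i = (1 / \<gamma>) *\<^sub>R (z i - x_g i)" for i
  have pos: "\<epsilon> > 0" "\<gamma> > 0" "lam > 0" "lam \<le> 2 - \<epsilon>" "2 * \<beta> * \<epsilon> - \<gamma> > 0"
    using \<epsilon> \<gamma> lam by (auto simp: \<alpha>)
  have \<Delta>0: "\<Delta> \<ge> 0" by (simp add: \<Delta>_def)
  have x_g_JB: "x_g i = JB (z i)" for i
    by (simp add: x_g JB_def)
  have x_f_JA: "x_f i = JA (2 *\<^sub>R x_g i - z i - \<gamma> *\<^sub>R C (x_g i))" for i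
    by (simp add: x_f JA_def)
  have JA_sub: "(1 / \<gamma>) *\<^sub>R (y - JA y) \<in> subdifferential f (JA y)" for y
    unfolding JA_def A using resolvent_subdifferential[OF f pos(2)] .
  have JB_sub: "(1 / \<gamma>) *\<^sub>R (y - JB y) \<in> subdifferential g (JB y)" for y
    unfolding JB_def B using resolvent_subdifferential[OF g pos(2)] .
  have uA_sub: "uA i \<in> subdifferential f (x_f i)" for i
    unfolding uA_def x_f_JA using JA_sub .
  have uB_sub: "uB i \<in> subdifferential g (x_g i)" for i
    unfolding uB_def x_g_JB using JB_sub .
  have h_sub: "C x \<in> subdifferential (\<lambda>x. ereal (h x)) x" for x
    by (rule gradient_in_subdifferential[OF h grad_h])
  have uBs_sub: "uBs \<in> subdifferential g xs"
    unfolding uBs xs using JB_sub by (simp add: JB_def)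
  have xs_JA: "JA (2 *\<^sub>R xs - zs - \<gamma> *\<^sub>R C xs) = xs"
    using zs unfolding T JA_def xs by (simp add: algebra_simps)
  \<comment> \<open>The fixed point thus provides subgradients of \<open>f\<close>, \<open>g\<close>
    and \<open>h\<close> at \<open>xs\<close> that add up to zero: the optimality condition behind
    both lower bounds.\<close>
  have uAs: "(1 / \<gamma>) *\<^sub>R (2 *\<^sub>R xs - zs - \<gamma> *\<^sub>R C xs - xs) = - (uBs + C xs)"
    using pos(2) by (simp add: uBs algebra_simps scaleR_2)
  then have uAs_sub: "- (uBs + C xs) \<in> subdifferential f xs"
    using JA_sub[of "2 *\<^sub>R xs - zs - \<gamma> *\<^sub>R C xs"] by (simp add: xs_JA)
  have z_step: "z (Suc i) = z i + lam *\<^sub>R D i" for i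
    by (simp add: z_Suc T D_def x_f x_g algebra_simps)
  have cocoercive: "\<beta> * (norm (C x - C y))\<^sup>2 \<le> (C x - C y) \<bullet> (x - y)" for x y
    by (rule baillon_haddad[OF h grad_h \<beta> lipschitz_C])

  \<comment> \<open>Fejer monotonicity and summable gradient errors\<close>
  have B_mono: "0 \<le> (x_g i - xs) \<bullet> ((z i - zs) - (x_g i - xs))" for i
  proof -
    have "0 \<le> (uB i - uBs) \<bullet> (x_g i - xs)"
      by (rule subdifferential_monotone[OF g uB_sub uBs_sub])
    also have "uB i - uBs = (1 / \<gamma>) *\<^sub>R ((z i - zs) - (x_g i - xs))"
      by (simp add: uB_def uBs algebra_simps)
    finally show ?thesis using pos(2) by (simp add: inner_commute zero_le_divide_iff)
  qed
  have A_mono: "0 \<le> (x_f i - xs) \<bullet> (2 *\<^sub>R (x_g i - xs) - (z i - zs)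
      - \<gamma> *\<^sub>R (C (x_g i) - C xs) - (x_f i - xs))" for i
  proof -
    have "0 \<le> (uA i - - (uBs + C xs)) \<bullet> (x_f i - xs)"
      by (rule subdifferential_monotone[OF f uA_sub uAs_sub])
    also have "uA i - - (uBs + C xs) = (1 / \<gamma>) *\<^sub>R (2 *\<^sub>R (x_g i - xs) - (z i - zs)
      - \<gamma> *\<^sub>R (C (x_g i) - C xs) - (x_f i - xs))"
      unfolding uAs[symmetric] uA_def by (simp add: algebra_simps)
    finally show ?thesis using pos(2) by (simp add: inner_commute zero_le_divide_iff)
  qed
  \<comment> \<open>The coefficient of the gradient error in \<open>davis_yin_fejer\<close>; it is
    positive because \<open>\<gamma> < 2 * \<beta> * \<epsilon>\<close>.\<close>
  define \<kappa> where "\<kappa> = lam * \<gamma> * (2 * \<beta> - \<gamma> / \<epsilon>)"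
  have \<kappa>: "\<kappa> > 0"
    using pos by (simp add: \<kappa>_def field_simps)
  have fejer: "(norm (z (Suc i) - zs))\<^sup>2 \<le> (norm (z i - zs))\<^sup>2 - \<kappa> * (norm (C (x_g i) - C xs))\<^sup>2" for i
  proof -
    have eq: "(z i - zs) + lam *\<^sub>R ((x_f i - xs) - (x_g i - xs)) = z (Suc i) - zs"
      by (simp add: z_step D_def)
    have "(norm ((z i - zs) + lam *\<^sub>R ((x_f i - xs) - (x_g i - xs))))\<^sup>2
      \<le> (norm (z i - zs))\<^sup>2 - lam * (2 - \<epsilon> - lam) * (norm ((x_f i - xs) - (x_g i - xs)))\<^sup>2
        - lam * \<gamma> * (2 * \<beta> - \<gamma> / \<epsilon>) * (norm (C (x_g i) - C xs))\<^sup>2"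
      by (rule davis_yin_fejer[OF pos(1-3) B_mono A_mono cocoercive])
    moreover have "0 \<le> lam * (2 - \<epsilon> - lam) * (norm ((x_f i - xs) - (x_g i - xs)))\<^sup>2"
      using pos by simp
    ultimately show ?thesis unfolding eq \<kappa>_def by linarith
  qed
  have z_bound: "norm (z i - zs) \<le> \<Delta>" for i
  proof (induction i)
    case (Suc i)
    have "0 \<le> \<kappa> * (norm (C (x_g i) - C xs))\<^sup>2" using \<kappa> by simp
    then have "(norm (z (Suc i) - zs))\<^sup>2 \<le> (norm (z i - zs))\<^sup>2" using fejer[of i] by linarith
    then show ?case using Suc by (meson norm_ge_zero order_trans power2_le_imp_le)
  qed (simp add: \<Delta>_def)
  have C_sum: "\<kappa> * (\<Sum>i=0..k. (norm (C (x_g i) - C xs))\<^sup>2) \<le> \<Delta>\<^sup>2" for k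
  proof -
    \<comment> \<open>The remaining squared distance is kept so that the induction can spend it in
      the next step.\<close>
    have "\<kappa> * (\<Sum>i=0..k. (norm (C (x_g i) - C xs))\<^sup>2) \<le> \<Delta>\<^sup>2 - (norm (z (Suc k) - zs))\<^sup>2"
    proof (induction k)
      case 0
      then show ?case using fejer[of 0] by (simp add: \<Delta>_def)
    next
      case (Suc k)
      then show ?case using fejer[of "Suc k"] by (simp add: distrib_left)
    qed
    also have "\<dots> \<le> \<Delta>\<^sup>2" by simp
    finally show ?thesis .
  qed

  \<comment> \<open>Ergodic averages and the distance between them\<close>
  define W where "W k = 2 / ((real k + 1) * (real k + 2))" for k
  define a where "a k i = W k * (real i + 1)" for k i
  have W0: "W k > 0" for k by (simp add: W_def)
  have W_mult: "W k * (real k + 1) = 2 / (real k + 2)" for k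
  proof -
    have "real k + 1 \<noteq> 0" "real k + 2 \<noteq> 0" by linarith+
    then show ?thesis unfolding W_def by (simp add: divide_eq_eq eq_divide_eq)
  qed
  have a0: "a k i \<ge> 0" for k i using W0[of k] by (simp add: a_def less_imp_le)
  have a1: "(\<Sum>i=0..k. a k i) = 1" for k
    unfolding a_def W_def by (rule sum_ergodic_weights)
  have xbar_f_sum: "xbar_f k = (\<Sum>i=0..k. a k i *\<^sub>R x_f i)" for k
    by (simp add: xbar_f a_def W_def scaleR_sum_right)
  have xbar_g_sum: "xbar_g k = (\<Sum>i=0..k. a k i *\<^sub>R x_g i)" for k
    by (simp add: xbar_g a_def W_def scaleR_sum_right)
  have gap: "norm (xbar_f k - xbar_g k) \<le> 5 * \<Delta> / (lam * (real k + 1))" for k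
  proof -
    have "lam *\<^sub>R (xbar_f k - xbar_g k) = W k *\<^sub>R (\<Sum>i=0..k. (real i + 1) *\<^sub>R (z (Suc i) - z i))"
      by (simp add: xbar_f_sum xbar_g_sum a_def z_step D_def scaleR_sum_right scaleR_diff_right
          sum_subtractf mult.commute mult.left_commute)
    then have "norm (lam *\<^sub>R (xbar_f k - xbar_g k))
        = norm (W k *\<^sub>R (\<Sum>i=0..k. (real i + 1) *\<^sub>R (z (Suc i) - z i)))"
      by (rule arg_cong)
    then have "lam * norm (xbar_f k - xbar_g k)
        = W k * norm (\<Sum>i=0..k. (real i + 1) *\<^sub>R (z (Suc i) - z i))"
      using pos(3) W0[of k] by (simp only: norm_scaleR abs_of_pos)
    also have "\<dots> \<le> W k * (2 * (real k + 1) * \<Delta>)"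
      using W0[of k] by (intro mult_left_mono norm_weighted_increments_le[OF z_bound]) simp
    also have "\<dots> = 2 * \<Delta> * (W k * (real k + 1))"
      by simp
    also have "\<dots> = 4 * \<Delta> / (real k + 2)"
      unfolding W_mult by simp
    \<comment> \<open>Abel summation gives 4 and \<open>k + 2\<close>; both are relaxed here to the
      form of the stated bounds.\<close>
    also have "\<dots> \<le> 5 * \<Delta> / (real k + 1)"
      using \<Delta>0 by (intro frac_le) auto
    finally have "norm (xbar_f k - xbar_g k) \<le> 5 * \<Delta> / (real k + 1) / lam"
      by (simp only: pos_le_divide_eq[OF pos(3)] mult.commute)
    then show ?thesis by (simp add: mult.commute)
  qed

  \<comment> \<open>The weighted sum of objective gaps\<close>
  obtain Fs where Fs: "f xs = ereal Fs"
    by (rule subdifferential_finite[OF f uAs_sub])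
  obtain Gs where Gs: "g xs = ereal Gs"
    by (rule subdifferential_finite[OF g uBs_sub])
  have "\<exists>r. f (x_f i) = ereal r" for i
    by (rule subdifferential_finite[OF f uA_sub[of i]]) blast
  then obtain F where F: "\<And>i. f (x_f i) = ereal (F i)" by metis
  have "\<exists>r. g (x_g i) = ereal r" for i
    by (rule subdifferential_finite[OF g uB_sub[of i]]) blast
  then obtain G where G: "\<And>i. g (x_g i) = ereal (G i)" by metis
  define H where "H i = h (x_g i)" for i
  define Q where "Q = 2 * (norm (zs - xs))\<^sup>2 + (2 + \<gamma> / (2 * \<beta> * \<epsilon> - \<gamma>)) * \<Delta>\<^sup>2
      + 10 * \<gamma> * \<Delta> * norm (C xs)"
  have Q0: "Q \<ge> 0" using pos \<Delta>0 by (simp add: Q_def)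
  define S where "S i = F i + G i + H i - (Fs + Gs + h xs)" for i

  have S_step: "\<gamma> * lam * S i \<le> ((norm (z i - xs))\<^sup>2 - (norm (z (Suc i) - xs))\<^sup>2) / 2
      + lam * \<gamma>\<^sup>2 / (2 * \<epsilon>) * (norm (C (x_g i) - C xs))\<^sup>2 - \<gamma> * (C xs \<bullet> (z (Suc i) - z i))" for i
  proof -
    have "F i + uA i \<bullet> (xs - x_f i) \<le> Fs" "G i + uB i \<bullet> (xs - x_g i) \<le> Gs"
      "H i + C (x_g i) \<bullet> (xs - x_g i) \<le> h xs"
      unfolding H_def
      by (rule subdifferential_ineq[OF uA_sub F Fs] subdifferential_ineq[OF uB_sub G Gs]
          subdifferential_ineq[OF h_sub refl refl])+
    then have "S i \<le> uA i \<bullet> (x_f i - xs) + uB i \<bullet> (x_g i - xs) + C (x_g i) \<bullet> (x_g i - xs)"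
      by (simp add: S_def inner_diff_right)
    then have "\<gamma> * lam * S i
        \<le> \<gamma> * lam * (uA i \<bullet> (x_f i - xs) + uB i \<bullet> (x_g i - xs) + C (x_g i) \<bullet> (x_g i - xs))"
      using pos by (intro mult_left_mono) auto
    also have "\<dots> \<le> ((norm (z i - xs))\<^sup>2 - (norm (z i + lam *\<^sub>R (x_f i - x_g i) - xs))\<^sup>2) / 2
      + lam * \<gamma>\<^sup>2 / (2 * \<epsilon>) * (norm (C (x_g i) - C xs))\<^sup>2
      - \<gamma> * (C xs \<bullet> (lam *\<^sub>R (x_f i - x_g i)))"
      unfolding uA_def uB_def by (rule davis_yin_objective[OF pos(1-4)])
    finally show ?thesis by (simp add: z_step D_def)
  qed

  have S_sum: "(\<Sum>i=0..k. a k i * S i) \<le> Q / (\<gamma> * lam * (real k + 1))" for k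
  proof -
    define n where "n = real k + 1"
    have n: "n > 0" by (simp add: n_def)
    let ?c = "\<lambda>i. (norm (C (x_g i) - C xs))\<^sup>2"
    let ?w = "\<lambda>i. real i + 1"
    have "\<gamma> * lam * (\<Sum>i=0..k. ?w i * S i) = (\<Sum>i=0..k. ?w i * (\<gamma> * lam * S i))"
      by (simp add: sum_distrib_left mult.left_commute)
    also have "\<dots> \<le> (\<Sum>i=0..k. ?w i * (((norm (z i - xs))\<^sup>2 - (norm (z (Suc i) - xs))\<^sup>2) / 2
      + lam * \<gamma>\<^sup>2 / (2 * \<epsilon>) * ?c i - \<gamma> * (C xs \<bullet> (z (Suc i) - z i))))"
      by (intro sum_mono mult_left_mono S_step) simp
    also have "\<dots> = - (\<Sum>i=0..k. ?w i *\<^sub>R ((norm (z (Suc i) - xs))\<^sup>2 - (norm (z i - xs))\<^sup>2)) / 2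
      + lam * \<gamma>\<^sup>2 / (2 * \<epsilon>) * (\<Sum>i=0..k. ?w i * ?c i)
      - \<gamma> * (C xs \<bullet> (\<Sum>i=0..k. ?w i *\<^sub>R (z (Suc i) - z i)))"
    proof -
      \<comment> \<open>Plain linearity, stated for arbitrary sequences. The sign of
        \<open>u\<close> is flipped to match \<open>weighted_telescope\<close>, whose differences
        run from \<open>i\<close> to \<open>Suc i\<close>.\<close>
      have "(\<Sum>i=0..k. ?w i * (u i / 2 + K * v i - \<gamma> * t i))
          = - (\<Sum>i=0..k. ?w i * (- u i)) / 2 + K * (\<Sum>i=0..k. ?w i * v i)
            - \<gamma> * (\<Sum>i=0..k. ?w i * t i)" for u v t :: "nat \<Rightarrow> real" and K
      proof -
        have "(\<Sum>i=0..k. ?w i * (u i / 2 + K * v i - \<gamma> * t i))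
            = (\<Sum>i=0..k. (?w i * u i) / 2 + K * (?w i * v i) - \<gamma> * (?w i * t i))"
          by (rule sum.cong) (simp_all add: algebra_simps add_divide_distrib)
        then show ?thesis
          by (simp add: sum.distrib sum_subtractf sum_negf
              flip: sum_distrib_left sum_divide_distrib)
      qed
      from this[of "\<lambda>i. (norm (z i - xs))\<^sup>2 - (norm (z (Suc i) - xs))\<^sup>2"
          "lam * \<gamma>\<^sup>2 / (2 * \<epsilon>)" ?c "\<lambda>i. C xs \<bullet> (z (Suc i) - z i)"]
      show ?thesis by (simp add: inner_sum_right)
    qed
    also have "\<dots> \<le> n * ((norm (zs - xs))\<^sup>2 + \<Delta>\<^sup>2) + n * (\<gamma> / (2 * \<beta> * \<epsilon> - \<gamma>) * \<Delta>\<^sup>2) / 2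
        + n * (2 * \<gamma> * \<Delta> * norm (C xs))"
    proof -
      have "(norm (z i - xs))\<^sup>2 \<le> 2 * ((norm (zs - xs))\<^sup>2 + \<Delta>\<^sup>2)" for i
      proof -
        have "norm (z i - xs) \<le> norm (z i - zs) + norm (zs - xs)"
          using norm_triangle_ineq[of "z i - zs" "zs - xs"] by simp
        then have "norm (z i - xs) \<le> \<Delta> + norm (zs - xs)" using z_bound[of i] by simp
        then have "(norm (z i - xs))\<^sup>2 \<le> (\<Delta> + norm (zs - xs))\<^sup>2" by (simp add: power_mono)
        also have "\<dots> \<le> 2 * ((norm (zs - xs))\<^sup>2 + \<Delta>\<^sup>2)"
          using zero_le_power2[of "\<Delta> - norm (zs - xs)"] by (simp add: power2_eq_square algebra_simps)
        finally show ?thesis .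
      qed
      then have "(\<Sum>i=0..k. (norm (z i - xs))\<^sup>2) \<le> (\<Sum>i=0..k. 2 * ((norm (zs - xs))\<^sup>2 + \<Delta>\<^sup>2))"
        by (intro sum_mono)
      then have "(\<Sum>i=0..k. (norm (z i - xs))\<^sup>2) \<le> n * (2 * ((norm (zs - xs))\<^sup>2 + \<Delta>\<^sup>2))"
        by (simp add: n_def algebra_simps)
      moreover have "0 \<le> n * (norm (z (Suc k) - xs))\<^sup>2" using n by simp
      ultimately have 1: "- (\<Sum>i=0..k. ?w i *\<^sub>R ((norm (z (Suc i) - xs))\<^sup>2 - (norm (z i - xs))\<^sup>2)) / 2
          \<le> n * ((norm (zs - xs))\<^sup>2 + \<Delta>\<^sup>2)"
        unfolding weighted_telescope[of "\<lambda>i. (norm (z i - xs))\<^sup>2" k]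
        by (simp add: distrib_left flip: n_def)
      have "(\<Sum>i=0..k. ?w i * ?c i) \<le> (\<Sum>i=0..k. n * ?c i)"
        by (intro sum_mono mult_right_mono) (auto simp: n_def)
      then have "\<kappa> * (\<Sum>i=0..k. ?w i * ?c i) \<le> \<kappa> * (n * (\<Sum>i=0..k. ?c i))"
        using \<kappa> by (simp flip: sum_distrib_left)
      also have "\<dots> = n * (\<kappa> * (\<Sum>i=0..k. ?c i))" by simp
      also have "\<dots> \<le> n * \<Delta>\<^sup>2" using C_sum n by (intro mult_left_mono) auto
      finally have "\<gamma> / (2 * \<beta> * \<epsilon> - \<gamma>) * (\<kappa> * (\<Sum>i=0..k. ?w i * ?c i))
          \<le> \<gamma> / (2 * \<beta> * \<epsilon> - \<gamma>) * (n * \<Delta>\<^sup>2)"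
        using pos by (intro mult_left_mono) auto
      \<comment> \<open>Origin of the constant
        \<open>\<gamma> / (2 * \<beta> * \<epsilon> - \<gamma>)\<close>: it is the ratio of twice
        the error coefficient in \<open>S_step\<close> to the Fejer coefficient
        \<open>\<kappa>\<close>.\<close>
      moreover have "\<gamma> / (2 * \<beta> * \<epsilon> - \<gamma>) * \<kappa> = lam * \<gamma>\<^sup>2 / \<epsilon>"
      proof -
        have "\<kappa> = lam * \<gamma> / \<epsilon> * (2 * \<beta> * \<epsilon> - \<gamma>)"
          using pos(1) by (simp add: \<kappa>_def field_simps)
        then show ?thesis using pos by (simp add: power2_eq_square)
      qed
      ultimately have "lam * \<gamma>\<^sup>2 / \<epsilon> * (\<Sum>i=0..k. ?w i * ?c i) \<le> \<gamma> / (2 * \<beta> * \<epsilon> - \<gamma>) * (n * \<Delta>\<^sup>2)"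
        by (simp add: mult.assoc[symmetric] del: times_divide_eq_left times_divide_eq_right)
      moreover have "lam * \<gamma>\<^sup>2 / (2 * \<epsilon>) * t = (lam * \<gamma>\<^sup>2 / \<epsilon> * t) / 2" for t
        by simp
      ultimately have 2: "lam * \<gamma>\<^sup>2 / (2 * \<epsilon>) * (\<Sum>i=0..k. ?w i * ?c i)
          \<le> n * (\<gamma> / (2 * \<beta> * \<epsilon> - \<gamma>) * \<Delta>\<^sup>2) / 2"
        by (simp only: mult.left_commute[of n] divide_right_mono zero_le_numeral)
      have "- (C xs \<bullet> (\<Sum>i=0..k. ?w i *\<^sub>R (z (Suc i) - z i)))
          \<le> norm (C xs) * norm (\<Sum>i=0..k. ?w i *\<^sub>R (z (Suc i) - z i))"
        using norm_cauchy_schwarz[of "- C xs" "\<Sum>i=0..k. ?w i *\<^sub>R (z (Suc i) - z i)"]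
        by (simp only: inner_minus_left norm_minus_cancel)
      also have "\<dots> \<le> norm (C xs) * (2 * n * \<Delta>)"
        unfolding n_def by (intro mult_left_mono norm_weighted_increments_le[OF z_bound]) simp
      finally have "\<gamma> * (- (C xs \<bullet> (\<Sum>i=0..k. ?w i *\<^sub>R (z (Suc i) - z i))))
          \<le> \<gamma> * (norm (C xs) * (2 * n * \<Delta>))"
        using pos(2) by (intro mult_left_mono) auto
      then have 3: "- (\<gamma> * (C xs \<bullet> (\<Sum>i=0..k. ?w i *\<^sub>R (z (Suc i) - z i))))
          \<le> n * (2 * \<gamma> * \<Delta> * norm (C xs))"
        by (simp add: mult.commute mult.left_commute)
      from 1 2 3 show ?thesis by argo
    qed
    also have "\<dots> \<le> n / 2 * Q"
    proof -
      \<comment> \<open>The estimate uses 2 of the 5 multiples of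
        \<open>\<gamma> * \<Delta> * norm (C xs)\<close> contained in \<open>Q / 2\<close>; the
        other 3 are slack.\<close>
      have "0 \<le> n * (3 * \<gamma> * \<Delta> * norm (C xs))" using n pos \<Delta>0 by simp
      moreover have "n / 2 * Q = n * ((norm (zs - xs))\<^sup>2 + \<Delta>\<^sup>2)
          + n * (\<gamma> / (2 * \<beta> * \<epsilon> - \<gamma>) * \<Delta>\<^sup>2) / 2
          + n * (2 * \<gamma> * \<Delta> * norm (C xs)) + n * (3 * \<gamma> * \<Delta> * norm (C xs))"
        unfolding Q_def by (simp add: distrib_left distrib_right add_divide_distrib)
      ultimately show ?thesis by linarith
    qed
    finally have "W k * (\<gamma> * lam * (\<Sum>i=0..k. ?w i * S i)) \<le> W k * (n / 2 * Q)"
      using W0[of k] by (intro mult_left_mono) auto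
    moreover have "W k * (\<gamma> * lam * (\<Sum>i=0..k. ?w i * S i)) = \<gamma> * lam * (\<Sum>i=0..k. a k i * S i)"
      by (simp add: a_def sum_distrib_left mult.commute mult.left_commute)
    moreover have "W k * (n / 2 * Q) = Q / (real k + 2)"
    proof -
      have "W k * (n / 2 * Q) = Q / 2 * (W k * (real k + 1))" by (simp add: n_def)
      moreover have "Q / 2 * (2 / t) = Q / t" for t by simp
      ultimately show ?thesis by (simp only: W_mult)
    qed
    moreover have "Q / (real k + 2) \<le> Q / (real k + 1)"
      using Q0 by (intro divide_left_mono) auto
    ultimately have "\<gamma> * lam * (\<Sum>i=0..k. a k i * S i) \<le> Q / (real k + 1)" by linarith
    then have "(\<Sum>i=0..k. a k i * S i) \<le> Q / (real k + 1) / (\<gamma> * lam)"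
      by (simp only: pos_le_divide_eq[OF mult_pos_pos[OF pos(2,3)]] mult.commute)
    then show ?thesis by (simp add: mult.commute)
  qed

  \<comment> \<open>Bounds with \<open>f\<close> and \<open>g\<close> at their own averages\<close>
  have main: "\<exists>Fb Gb. f (xbar_f k) = ereal Fb \<and> g (xbar_g k) = ereal Gb \<and>
      - 5 * \<Delta> * norm (uBs + C xs) / (lam * (real k + 1))
        \<le> Fb + Gb + h (xbar_g k) - (Fs + Gs + h xs) \<and>
      Fb + Gb + h (xbar_g k) - (Fs + Gs + h xs) \<le> Q / (\<gamma> * lam * (real k + 1))" for k
  proof -
    have F_le: "f (xbar_f k) \<le> ereal (\<Sum>i=0..k. a k i * F i)"
      unfolding xbar_f_sum by (intro proper_closed_convex_sum_le f a0 a1 F) simp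
    have G_le: "g (xbar_g k) \<le> ereal (\<Sum>i=0..k. a k i * G i)"
      unfolding xbar_g_sum by (intro proper_closed_convex_sum_le g a0 a1 G) simp
    have "ereal (h (xbar_g k)) \<le> ereal (\<Sum>i=0..k. a k i * H i)"
      unfolding xbar_g_sum H_def
      by (intro proper_closed_convex_sum_le[where f = "\<lambda>x. ereal (h x)"] h a0 a1) simp_all
    then have H_le: "h (xbar_g k) \<le> (\<Sum>i=0..k. a k i * H i)" by simp
    obtain Fb where Fb: "f (xbar_f k) = ereal Fb"
      using F_le by (cases "xbar_f k" rule: proper_closed_convex_ereal_cases[OF f]) auto
    obtain Gb where Gb: "g (xbar_g k) = ereal Gb"
      using G_le by (cases "xbar_g k" rule: proper_closed_convex_ereal_cases[OF g]) auto
    have "(\<Sum>i=0..k. a k i * S i) = (\<Sum>i=0..k. a k i * F i) + (\<Sum>i=0..k. a k i * G i)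
        + (\<Sum>i=0..k. a k i * H i) - (\<Sum>i=0..k. a k i) * (Fs + Gs + h xs)"
      by (simp only: S_def sum_distrib_right distrib_left right_diff_distrib sum.distrib sum_subtractf)
    then have upper: "Fb + Gb + h (xbar_g k) - (Fs + Gs + h xs) \<le> Q / (\<gamma> * lam * (real k + 1))"
      using F_le G_le H_le S_sum[of k] by (simp add: Fb Gb a1)
    \<comment> \<open>The three subgradients at \<open>xs\<close> sum to zero, so only their pairing
      with \<open>xbar_f k - xbar_g k\<close> survives, and \<open>gap\<close> bounds it.\<close>
    have "Fs + - (uBs + C xs) \<bullet> (xbar_f k - xs) \<le> Fb" "Gs + uBs \<bullet> (xbar_g k - xs) \<le> Gb"
      "h xs + C xs \<bullet> (xbar_g k - xs) \<le> h (xbar_g k)"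
      by (rule subdifferential_ineq[OF uAs_sub Fs Fb] subdifferential_ineq[OF uBs_sub Gs Gb]
          subdifferential_ineq[OF h_sub refl refl])+
    then have "- ((uBs + C xs) \<bullet> (xbar_f k - xbar_g k)) \<le> Fb + Gb + h (xbar_g k) - (Fs + Gs + h xs)"
      by (simp add: inner_diff_right inner_diff_left inner_add_left)
    moreover have "(uBs + C xs) \<bullet> (xbar_f k - xbar_g k)
        \<le> norm (uBs + C xs) * (5 * \<Delta> / (lam * (real k + 1)))"
      by (rule order_trans[OF norm_cauchy_schwarz mult_left_mono[OF gap]]) simp
    ultimately have "- 5 * \<Delta> * norm (uBs + C xs) / (lam * (real k + 1))
        \<le> Fb + Gb + h (xbar_g k) - (Fs + Gs + h xs)"
      by (simp add: mult.commute mult.left_commute)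
    then show ?thesis using Fb Gb upper by blast
  qed

  \<comment> \<open>A ball containing both averages\<close>
  define R where "R = (1 + \<gamma> / \<beta>) * \<Delta>"
  have x_g_norm: "norm (x_g i - xs) \<le> \<Delta>" for i
  proof -
    have "(x_g i - xs) \<bullet> (x_g i - xs) \<le> (x_g i - xs) \<bullet> (z i - zs)"
      using B_mono[of i] by (simp only: inner_diff_right[of "x_g i - xs" "z i - zs"])
    also have "\<dots> \<le> norm (x_g i - xs) * norm (z i - zs)" by (rule norm_cauchy_schwarz)
    finally have "norm (x_g i - xs) * norm (x_g i - xs) \<le> norm (x_g i - xs) * norm (z i - zs)"
      by (simp add: power2_norm_eq_inner flip: power2_eq_square)
    then have "norm (x_g i - xs) \<le> norm (z i - zs)"
      by (cases "x_g i = xs") auto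
    then show ?thesis using z_bound[of i] by simp
  qed
  have x_f_norm: "norm (x_f i - xs) \<le> R" for i
  proof -
    define p where "p = x_g i - xs"
    define w where "w = z i - zs"
    define c where "c = C (x_g i) - C xs"
    define q where "q = x_f i - xs"
    \<comment> \<open>The reflected resolvent is nonexpansive, which gives the 1 in the radius; the
      Lipschitz gradient step adds \<open>\<gamma> / \<beta>\<close>, and the outer resolvent does
      not expand.\<close>
    have "(norm (2 *\<^sub>R p - w))\<^sup>2 = (norm w)\<^sup>2 - 4 * (p \<bullet> (w - p))"
      unfolding power2_norm_eq_inner by (simp add: inner_diff_left inner_diff_right inner_commute)
    then have "(norm (2 *\<^sub>R p - w))\<^sup>2 \<le> (norm w)\<^sup>2" using B_mono[of i] by (simp add: p_def w_def)
    then have "norm (2 *\<^sub>R p - w) \<le> \<Delta>"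
      using z_bound[of i] unfolding w_def by (meson norm_ge_zero order_trans power2_le_imp_le)
    moreover have "norm (\<gamma> *\<^sub>R c) \<le> \<gamma> / \<beta> * \<Delta>"
    proof -
      have "norm c \<le> 1 / \<beta> * norm p"
        using lipschitz_onD[OF lipschitz_C, of "x_g i" xs] by (simp add: c_def p_def dist_norm)
      also have "\<dots> \<le> 1 / \<beta> * \<Delta>" using \<beta> x_g_norm[of i] by (intro mult_left_mono) (auto simp: p_def)
      finally have "\<gamma> * norm c \<le> \<gamma> * (1 / \<beta> * \<Delta>)" using pos(2) by (intro mult_left_mono) auto
      then show ?thesis using pos(2) by simp
    qed
    moreover have "norm (2 *\<^sub>R p - w - \<gamma> *\<^sub>R c) \<le> norm (2 *\<^sub>R p - w) + norm (\<gamma> *\<^sub>R c)"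
      by (rule norm_triangle_ineq4)
    ultimately have bound: "norm (2 *\<^sub>R p - w - \<gamma> *\<^sub>R c) \<le> R" by (simp add: R_def distrib_right)
    have "0 \<le> q \<bullet> (2 *\<^sub>R p - w - \<gamma> *\<^sub>R c - q)"
      using A_mono[of i] by (simp only: p_def w_def c_def q_def)
    then have "q \<bullet> q \<le> q \<bullet> (2 *\<^sub>R p - w - \<gamma> *\<^sub>R c)"
      by (simp only: inner_diff_right[of q "2 *\<^sub>R p - w - \<gamma> *\<^sub>R c"])
    also have "\<dots> \<le> norm q * norm (2 *\<^sub>R p - w - \<gamma> *\<^sub>R c)" by (rule norm_cauchy_schwarz)
    finally have "norm q * norm q \<le> norm q * norm (2 *\<^sub>R p - w - \<gamma> *\<^sub>R c)"
      by (simp add: power2_norm_eq_inner flip: power2_eq_square)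
    then have "norm q \<le> norm (2 *\<^sub>R p - w - \<gamma> *\<^sub>R c)" by (cases "q = 0") auto
    then show ?thesis using bound by (simp add: q_def)
  qed
  have "\<Delta> \<le> R" using pos(2) \<beta> \<Delta>0 by (simp add: R_def distrib_right)
  then have x_g_R: "norm (x_g i - xs) \<le> R" for i using x_g_norm order_trans by blast
  have xbar_f_ball: "xbar_f k \<in> cball xs R" for k
    unfolding xbar_f_sum using x_f_norm
    by (intro convex_sum a0 a1) (auto simp: dist_norm norm_minus_commute)
  have xbar_g_ball: "xbar_g k \<in> cball xs R" for k
    unfolding xbar_g_sum using x_g_R
    by (intro convex_sum a0 a1) (auto simp: dist_norm norm_minus_commute)

  \<comment> \<open>Bounds with all three functions at \<open>xbar_g k\<close>\<close>
  have part2: "\<exists>Fb Gb. f (xbar_g k) = ereal Fb \<and> g (xbar_g k) = ereal Gb \<and>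
      0 \<le> Fb + Gb + h (xbar_g k) - (Fs + Gs + h xs) \<and>
      Fb + Gb + h (xbar_g k) - (Fs + Gs + h xs)
        \<le> (Q + 5 * \<gamma> * L * \<Delta>) / (\<gamma> * lam * (real k + 1))"
    if fin: "\<forall>x \<in> cball xs R. \<bar>f x\<bar> \<noteq> \<infinity>"
      and lip: "L-lipschitz_on (cball xs R) (\<lambda>x. real_of_ereal (f x))" for L k
  proof -
    obtain Fb Gb where 1: "f (xbar_f k) = ereal Fb" "g (xbar_g k) = ereal Gb"
      "Fb + Gb + h (xbar_g k) - (Fs + Gs + h xs) \<le> Q / (\<gamma> * lam * (real k + 1))"
      using main[of k] by blast
    obtain Fb' where Fb': "f (xbar_g k) = ereal Fb'"
      using bspec[OF fin xbar_g_ball[of k]] by (cases "f (xbar_g k)") auto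
    \<comment> \<open>Moving the argument of \<open>f\<close> from \<open>xbar_f k\<close> to
      \<open>xbar_g k\<close> costs at most \<open>L\<close> times \<open>gap\<close>; both points
      lie in the ball.\<close>
    have "Fb' - Fb \<le> dist Fb' Fb" by (simp add: dist_real_def)
    also have "\<dots> \<le> L * norm (xbar_f k - xbar_g k)"
      using lipschitz_onD[OF lip xbar_g_ball[of k] xbar_f_ball[of k]]
      by (simp add: 1 Fb' dist_norm norm_minus_commute)
    also have "\<dots> \<le> L * (5 * \<Delta> / (lam * (real k + 1)))"
      by (rule mult_left_mono[OF gap lipschitz_on_nonneg[OF lip]])
    also have "\<dots> = 5 * \<gamma> * L * \<Delta> / (\<gamma> * lam * (real k + 1))"
      using pos(2) by simp
    finally have upper: "Fb' + Gb + h (xbar_g k) - (Fs + Gs + h xs)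
        \<le> (Q + 5 * \<gamma> * L * \<Delta>) / (\<gamma> * lam * (real k + 1))"
      using 1(3) by (simp only: add_divide_distrib)
    \<comment> \<open>With a common argument the subgradient terms cancel completely, which is why
      the lower bound is 0.\<close>
    have "Fs + - (uBs + C xs) \<bullet> (xbar_g k - xs) \<le> Fb'" "Gs + uBs \<bullet> (xbar_g k - xs) \<le> Gb"
      "h xs + C xs \<bullet> (xbar_g k - xs) \<le> h (xbar_g k)"
      by (rule subdifferential_ineq[OF uAs_sub Fs Fb'] subdifferential_ineq[OF uBs_sub Gs 1(2)]
          subdifferential_ineq[OF h_sub refl refl])+
    then have "0 \<le> Fb' + Gb + h (xbar_g k) - (Fs + Gs + h xs)"
      by (simp add: inner_diff_right inner_diff_left inner_add_left)
    then show ?thesis using Fb' 1(2) upper by blast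
  qed

  show ?thesis
    unfolding \<Delta>_def[symmetric] R_def[symmetric] Q_def[symmetric]
  proof (intro conjI allI impI; (elim conjE)?)
    fix k
    obtain Fb Gb where "f (xbar_f k) = ereal Fb" "g (xbar_g k) = ereal Gb"
      "- 5 * \<Delta> * norm (uBs + C xs) / (lam * (real k + 1))
        \<le> Fb + Gb + h (xbar_g k) - (Fs + Gs + h xs)"
      "Fb + Gb + h (xbar_g k) - (Fs + Gs + h xs) \<le> Q / (\<gamma> * lam * (real k + 1))"
      using main[of k] by blast
    then show "ereal (- 5 * \<Delta> * norm (uBs + C xs) / (lam * (real k + 1)))
          \<le> f (xbar_f k) + g (xbar_g k) + ereal (h (xbar_g k)) - (f xs + g xs + ereal (h xs))"
      and "f (xbar_f k) + g (xbar_g k) + ereal (h (xbar_g k)) - (f xs + g xs + ereal (h xs))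
          \<le> ereal (Q / (\<gamma> * lam * (real k + 1)))"
      by (simp_all add: Fs Gs)
  next
    fix L k
    assume "\<forall>x \<in> cball xs R. \<bar>f x\<bar> \<noteq> \<infinity>"
      and "L-lipschitz_on (cball xs R) (\<lambda>x. real_of_ereal (f x))"
    from part2[OF this, of k] obtain Fb Gb where
      "f (xbar_g k) = ereal Fb" "g (xbar_g k) = ereal Gb"
      "0 \<le> Fb + Gb + h (xbar_g k) - (Fs + Gs + h xs)"
      "Fb + Gb + h (xbar_g k) - (Fs + Gs + h xs)
        \<le> (Q + 5 * \<gamma> * L * \<Delta>) / (\<gamma> * lam * (real k + 1))"
      by blast
    then show "0 \<le> f (xbar_g k) + g (xbar_g k) + ereal (h (xbar_g k))
          - (f xs + g xs + ereal (h xs))"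
      and "f (xbar_g k) + g (xbar_g k) + ereal (h (xbar_g k)) - (f xs + g xs + ereal (h xs))
          \<le> ereal ((Q + 5 * \<gamma> * L * \<Delta>) / (\<gamma> * lam * (real k + 1)))"
      by (simp_all add: Fs Gs)
  qed
qed

end
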